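(* Let $C$ be a quaternary Hermitian LCD $[n,k,d]$ code with $d \ge 2$ and $d^{\perp h} \ge 2$, where $d^{\perp h}$ is the minimum weight of $C^{\perp h}$. Then for all $1 \le i \le n$, exactly one of the punctured code $C^i$ and the shortened code $C_i$ is a Hermitian LCD code.
   Context: A quaternary $[n,k]$ code is a $k$-dimensional subspace $C$ of $\mathbb{F}_4^n$. The weight of a vector is its number of nonzero coordinates; the minimum weight of $C$ is the smallest weight of a nonzero codeword, and an $[n,k,d]$ code is an $[n,k]$ code with minimum weight $d$. For $a\in\mathbb{F}_4$, $\overline{a}=a^2$. The Hermitian inner product of $u,v\in\mathbb{F}_4^m$ is $(u,v)_h=\sum_{j=1}^m u_j\overline{v_j}$, and for a code $C$ of length $m$, $C^{\perp h}=\{u\in\mathbb{F}_4^m\mid (u,v)_h=0\text{ for all }v\in C\}$. $C$ is a Hermitian LCD code if $C\cap C^{\perp h}=\{0\}$. The punctured code $C^i$ is the code of length $n-1$ obtained by deleting the $i$-th coordinate from every codeword of $C$. The shortened code $C_i$ is the code of length $n-1$ obtained by deleting the $i$-th coordinate from every codeword of the subcode $\{(c_1,\dots,c_n)\in C\mid c_i=0\}$. *)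

theory Defs
  imports
    "HOL-Library.Cardinality"
    "Jordan_Normal_Form.VS_Connect"
    "Jordan_Normal_Form.Determinant"
begin

(* F_4 is rendered as an arbitrary field type 'a with CARD('a) = 4 (assumed where needed), and
   F_4^n as carrier_vec n.  Coordinates are therefore numbered 0, ..., n - 1. *)

definition conj4 :: "'a::field \<Rightarrow> 'a" where
  "conj4 a = a ^ 2"

definition herm_inner :: "'a::field vec \<Rightarrow> 'a vec \<Rightarrow> 'a" where
  "herm_inner u v = u \<bullet> map_vec conj4 v"

definition weight :: "'a::zero vec \<Rightarrow> nat" where
  "weight v = card {j. j < dim_vec v \<and> v $ j \<noteq> 0}"

definition linear_code :: "nat \<Rightarrow> 'a::field vec set \<Rightarrow> bool" where
  "linear_code n C \<longleftrightarrow> subspace class_ring C (module_vec TYPE('a) n)"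

definition code_dim :: "nat \<Rightarrow> 'a::field vec set \<Rightarrow> nat" where
  "code_dim n C = vectorspace.dim class_ring ((module_vec TYPE('a) n)\<lparr>carrier := C\<rparr>)"

(* A relation rather than a function: the zero code has no minimum weight. *)
definition is_min_weight :: "nat \<Rightarrow> 'a::field vec set \<Rightarrow> nat \<Rightarrow> bool" where
  "is_min_weight n C d \<longleftrightarrow>
     (\<exists>c\<in>C. c \<noteq> 0\<^sub>v n \<and> weight c = d) \<and> (\<forall>c\<in>C. c \<noteq> 0\<^sub>v n \<longrightarrow> d \<le> weight c)"

definition nk_code :: "nat \<Rightarrow> nat \<Rightarrow> 'a::field vec set \<Rightarrow> bool" where
  "nk_code n k C \<longleftrightarrow> linear_code n C \<and> code_dim n C = k"

definition nkd_code :: "nat \<Rightarrow> nat \<Rightarrow> nat \<Rightarrow> 'a::field vec set \<Rightarrow> bool" where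
  "nkd_code n k d C \<longleftrightarrow> nk_code n k C \<and> is_min_weight n C d"

definition herm_dual :: "nat \<Rightarrow> 'a::field vec set \<Rightarrow> 'a vec set" where
  "herm_dual n C = {u \<in> carrier_vec n. \<forall>v\<in>C. herm_inner u v = 0}"

definition hermitian_LCD :: "nat \<Rightarrow> 'a::field vec set \<Rightarrow> bool" where
  "hermitian_LCD n C \<longleftrightarrow> linear_code n C \<and> C \<inter> herm_dual n C = {0\<^sub>v n}"

(* insert_index i is the increasing enumeration of the indices other than i. *)
definition delete_coord :: "nat \<Rightarrow> 'a vec \<Rightarrow> 'a vec" where
  "delete_coord i v = vec (dim_vec v - 1) (\<lambda>j. v $ insert_index i j)"

definition punctured :: "nat \<Rightarrow> 'a vec set \<Rightarrow> 'a vec set" where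
  "punctured i C = delete_coord i ` C"

definition shortened :: "nat \<Rightarrow> 'a::zero vec set \<Rightarrow> 'a vec set" where
  "shortened i C = delete_coord i ` {c \<in> C. c $ i = 0}"

end

theory Submission
  imports Defs
begin

text \<open>Since \<open>C\<close> is Hermitian LCD, the coordinate functional \<open>x \<mapsto> x\<^sub>i\<close> on \<open>C\<close> equals
  \<open>x \<mapsto> (x, a)\<^sub>h\<close> for some \<open>a \<in> C\<close>; then \<open>a\<^sub>i = (a, a)\<^sub>h\<close> is fixed by conjugation, so it is
  \<open>0\<close> or \<open>1\<close>. The radical of the shortened code is spanned by the image of \<open>a\<close> if \<open>a\<^sub>i = 0\<close> and
  is trivial if \<open>a\<^sub>i = 1\<close>; for the punctured code it is the other way round. The two weight
  conditions ensure that \<open>a\<close> and its image after deleting coordinate \<open>i\<close> are nonzero.\<close>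

section \<open>Linear codes and finiteness of the ambient space\<close>

lemma linear_code_iff:
  fixes C :: "'a::field vec set"
  shows "linear_code n C \<longleftrightarrow>
    C \<subseteq> carrier_vec n \<and> 0\<^sub>v n \<in> C \<and> (\<forall>x\<in>C. \<forall>y\<in>C. x + y \<in> C) \<and> (\<forall>c. \<forall>x\<in>C. c \<cdot>\<^sub>v x \<in> C)"
proof -
  have "vectorspace (class_ring :: 'a ring) (module_vec TYPE('a) n)"
    by (rule vec_vs)
  moreover from this have "module (class_ring :: 'a ring) (module_vec TYPE('a) n)"
    by (simp add: vectorspace_def)
  ultimately show ?thesis
    unfolding linear_code_def subspace_def submodule_def module_vec_simps class_ring_simps
    by auto
qed

lemma fixes C :: "'a::field vec set"
  assumes "linear_code n C"
  shows linear_code_carrier: "x \<in> C \<Longrightarrow> x \<in> carrier_vec n"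
    and linear_code_add: "x \<in> C \<Longrightarrow> y \<in> C \<Longrightarrow> x + y \<in> C"
    and linear_code_smult: "x \<in> C \<Longrightarrow> c \<cdot>\<^sub>v x \<in> C"
  using assms by (auto simp: linear_code_iff)

text \<open>Makes every code over a finite field finite, so that
  \<open>functional_represented\<close> can be applied with the whole code as its finite set
  \<open>S\<close>.\<close>

lemma finite_carrier_vec:
  assumes "finite (UNIV :: 'a set)"
  shows "finite (carrier_vec n :: 'a vec set)"
proof (rule finite_subset)
  show "carrier_vec n \<subseteq> vec n ` ({..<n} \<rightarrow>\<^sub>E (UNIV :: 'a set))"
  proof
    fix v :: "'a vec" assume "v \<in> carrier_vec n"
    then have "v = vec n (\<lambda>j\<in>{..<n}. v $ j)"
      by (intro eq_vecI) auto
    then show "v \<in> vec n ` ({..<n} \<rightarrow>\<^sub>E UNIV)"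
      by (metis UNIV_I image_eqI restrict_PiE_iff)
  qed
  show "finite (vec n ` ({..<n} \<rightarrow>\<^sub>E (UNIV :: 'a set)))"
    using assms by (intro finite_imageI finite_PiE) auto
qed

text \<open>Multiplication by a nonzero \<open>x\<close> permutes the nonzero elements. Comparing
  the product of these elements before and after, and cancelling it, gives
  \<open>x ^ (CARD('a) - 1) = 1\<close>.\<close>

lemma power_card_field:
  fixes x :: "'a::field"
  assumes fin: "finite (UNIV :: 'a set)"
  shows "x ^ CARD('a) = x"
proof (cases "x = 0")
  case True
  have "CARD('a) > 0"
    using fin by (simp add: card_gt_0_iff)
  with True show ?thesis
    by (metis zero_power)
next
  case False
  let ?U = "UNIV - {0 :: 'a}"
  have "bij_betw ((*) x) ?U ?U"
    by (rule bij_betwI[of _ _ _ "\<lambda>y. y / x"]) (use False in auto)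
  then have "(\<Prod>y\<in>?U. y) = (\<Prod>y\<in>?U. x * y)"
    by (rule prod.reindex_bij_betw[symmetric])
  also have "\<dots> = x ^ card ?U * (\<Prod>y\<in>?U. y)"
    by (simp add: prod.distrib)
  finally have "x ^ card ?U = 1"
    using fin by simp
  moreover have "CARD('a) = Suc (card ?U)"
    using fin by (metis UNIV_I card.remove)
  ultimately show ?thesis
    by (metis mult.right_neutral power_Suc)
qed

text \<open>Here \<open>power_card_field\<close> reads \<open>z ^ 4 = z\<close>. At
  \<open>z = -1\<close> it gives \<open>1 = -1\<close>, so the characteristic is two and the cross
  term of a squared sum vanishes; it also shows that squaring twice is the identity.\<close>

lemma
  fixes x y :: "'a::field"
  assumes card: "CARD('a) = 4"
  shows conj4_add: "conj4 (x + y) = conj4 x + conj4 y"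
    and conj4_mult: "conj4 (x * y) = conj4 x * conj4 y"
    and conj4_conj4: "conj4 (conj4 x) = x"
proof -
  have p4: "z ^ 4 = z" for z :: 'a
    using power_card_field[of z] card by (simp add: card_ge_0_finite)
  have "(1::'a) = -1"
    using p4[of "-1"] by simp
  then have "(2::'a) = 0"
    by (metis add.right_inverse one_add_one)
  then show "conj4 (x + y) = conj4 x + conj4 y"
    by (simp add: conj4_def power2_sum)
  show "conj4 (x * y) = conj4 x * conj4 y"
    by (simp add: conj4_def power_mult_distrib)
  show "conj4 (conj4 x) = x"
    using p4[of x] by (simp add: conj4_def flip: power_mult)
qed

lemma conj4_0 [simp]: "conj4 0 = 0"
  by (simp add: conj4_def)

section \<open>The Hermitian form and the functionals it represents\<close>

lemma herm_inner_sum: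
  assumes "v \<in> carrier_vec n"
  shows "herm_inner u v = (\<Sum>j<n. u $ j * conj4 (v $ j))"
  using assms by (simp add: herm_inner_def scalar_prod_def atLeast0LessThan)

lemma herm_inner_add_left:
  assumes "u \<in> carrier_vec n" "v \<in> carrier_vec n" "w \<in> carrier_vec n"
  shows "herm_inner (u + v) w = herm_inner u w + herm_inner v w"
  using assms by (simp add: herm_inner_sum distrib_right sum.distrib)

lemma herm_inner_smult_left:
  assumes "u \<in> carrier_vec n" "w \<in> carrier_vec n"
  shows "herm_inner (c \<cdot>\<^sub>v u) w = c * herm_inner u w"
  using assms by (simp add: herm_inner_sum sum_distrib_left mult.assoc)

lemma herm_inner_zero_left: "w \<in> carrier_vec n \<Longrightarrow> herm_inner (0\<^sub>v n) w = 0"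
  by (simp add: herm_inner_sum)

lemma herm_inner_commute:
  fixes u v :: "'a::field vec"
  assumes card: "CARD('a) = 4" and uv: "u \<in> carrier_vec n" "v \<in> carrier_vec n"
  shows "herm_inner v u = conj4 (herm_inner u v)"
proof -
  have *: "conj4 (\<Sum>j\<in>J. f j) = (\<Sum>j\<in>J. conj4 (f j))" for f :: "nat \<Rightarrow> 'a" and J
    by (induction J rule: infinite_finite_induct) (auto simp: conj4_add[OF card])
  show ?thesis
    using uv by (simp add: herm_inner_sum * conj4_mult[OF card] conj4_conj4[OF card] mult.commute)
qed

lemma herm_inner_add_right:
  fixes u v w :: "'a::field vec"
  assumes "CARD('a) = 4" "u \<in> carrier_vec n" "v \<in> carrier_vec n" "w \<in> carrier_vec n"
  shows "herm_inner u (v + w) = herm_inner u v + herm_inner u w"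
  using assms by (simp add: herm_inner_sum[where n = n] conj4_add distrib_left sum.distrib)

lemma herm_inner_smult_right:
  fixes u v :: "'a::field vec"
  assumes "CARD('a) = 4" "u \<in> carrier_vec n" "v \<in> carrier_vec n"
  shows "herm_inner u (c \<cdot>\<^sub>v v) = conj4 c * herm_inner u v"
  using assms by (simp add: herm_inner_sum conj4_mult sum_distrib_left mult.left_commute)

text \<open>A functional that vanishes on the common kernel of finitely many functionals
  \<open>herm_inner _ y\<close> is a linear combination of them. The induction adds one
  \<open>y\<close> at a time and must vary \<open>f\<close>, since each step subtracts a multiple of
  the new functional.\<close>

lemma functional_represented:
  fixes C :: "'a::field vec set"
  assumes card: "CARD('a) = 4" and C: "linear_code n C" and "finite S" "S \<subseteq> C"
    and "\<And>x y. x \<in> C \<Longrightarrow> y \<in> C \<Longrightarrow> f (x + y) = f x + f y"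
    and "\<And>c x. x \<in> C \<Longrightarrow> f (c \<cdot>\<^sub>v x) = c * f x"
    and "\<And>x. x \<in> C \<Longrightarrow> \<forall>y\<in>S. herm_inner x y = 0 \<Longrightarrow> f x = 0"
  shows "\<exists>a\<in>C. \<forall>x\<in>C. f x = herm_inner x a"
  using assms(3-)
proof (induction S arbitrary: f rule: finite_induct)
  case empty
  have "0\<^sub>v n \<in> C"
    using C by (simp add: linear_code_iff)
  moreover have "herm_inner x (0\<^sub>v n) = 0" for x :: "'a vec"
    by (simp add: herm_inner_sum[where n = n])
  ultimately show ?case
    using empty by (intro bexI[of _ "0\<^sub>v n"]) auto
next
  case (insert y S)
  note carr = linear_code_carrier[OF C] and add = linear_code_add[OF C]
    and smult = linear_code_smult[OF C]
  have y: "y \<in> C" and S: "S \<subseteq> C"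
    using insert.prems(1) by auto
  show ?case
  proof (cases "\<forall>x\<in>C. (\<forall>z\<in>S. herm_inner x z = 0) \<longrightarrow> herm_inner x y = 0")
    \<comment> \<open>The new functional already vanishes on the common kernel for \<open>S\<close>,
      so that kernel does not shrink and \<open>f\<close> itself satisfies the induction
      hypothesis.\<close>
    case True
    then show ?thesis
      by (intro insert.IH S insert.prems) auto
  next
    case False
    then obtain x0 where x0: "x0 \<in> C" "\<forall>z\<in>S. herm_inner x0 z = 0" "herm_inner x0 y \<noteq> 0"
      by auto
    \<comment> \<open>This \<open>t\<close> makes \<open>g\<close> vanish at
      \<open>x0\<close>.\<close>
    define t where "t = f x0 / herm_inner x0 y"
    define g where "g = (\<lambda>x. f x - t * herm_inner x y)"
    have "\<exists>a\<in>C. \<forall>x\<in>C. g x = herm_inner x a"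
    proof (rule insert.IH[OF S])
      fix x z assume "x \<in> C" "z \<in> C"
      then show "g (x + z) = g x + g z"
        using y by (simp add: g_def insert.prems herm_inner_add_left[where n = n] carr algebra_simps)
    next
      fix c x assume "x \<in> C"
      then show "g (c \<cdot>\<^sub>v x) = c * g x"
        using y by (simp add: g_def insert.prems herm_inner_smult_left[where n = n] carr algebra_simps)
    next
      fix x assume x: "x \<in> C" "\<forall>z\<in>S. herm_inner x z = 0"
      \<comment> \<open>Adding \<open>r\<close> times \<open>x0\<close> makes \<open>x\<close>
        orthogonal to \<open>y\<close> while keeping it orthogonal to \<open>S\<close>. Hence
        \<open>f x = - r * f x0\<close>, which is \<open>t * herm_inner x y\<close>.\<close>
      define r where "r = - (herm_inner x y / herm_inner x0 y)"
      have "herm_inner (x + r \<cdot>\<^sub>v x0) z = herm_inner x z + r * herm_inner x0 z" if "z \<in> C" for z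
        using that x x0(1) smult
        by (simp add: herm_inner_add_left[where n = n] herm_inner_smult_left[where n = n] carr)
      then have "\<forall>z\<in>insert y S. herm_inner (x + r \<cdot>\<^sub>v x0) z = 0"
        using x x0 y S by (auto simp: r_def)
      then have "f (x + r \<cdot>\<^sub>v x0) = 0"
        using x x0 by (intro insert.prems(4)) (auto intro: add smult)
      moreover have "f (x + r \<cdot>\<^sub>v x0) = f x + r * f x0"
        using x x0 by (simp add: insert.prems smult)
      ultimately show "g x = 0"
        by (simp add: g_def t_def r_def)
    qed
    then obtain a where a: "a \<in> C" "\<forall>x\<in>C. g x = herm_inner x a"
      by auto
    \<comment> \<open>The form is conjugate-linear on the right, so the coefficient \<open>t\<close>
      enters the representing vector as \<open>conj4 t\<close>.\<close>
    have "f x = herm_inner x (a + conj4 t \<cdot>\<^sub>v y)" if x: "x \<in> C" for x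
    proof -
      have "herm_inner x (a + conj4 t \<cdot>\<^sub>v y) = herm_inner x a + t * herm_inner x y"
        using x y a(1) card
        by (simp add: herm_inner_add_right[where n = n] herm_inner_smult_right[where n = n]
            conj4_conj4 carr)
      moreover have "f x = g x + t * herm_inner x y"
        by (simp add: g_def)
      ultimately show ?thesis using a x by simp
    qed
    then show ?thesis
      using a(1) y add smult by blast
  qed
qed

lemma LCD_coordinate_represented:
  fixes C :: "'a::field vec set"
  assumes card: "CARD('a) = 4" and LCD: "hermitian_LCD n C" and i: "i < n"
  obtains a where "a \<in> C" "\<And>x. x \<in> C \<Longrightarrow> herm_inner x a = x $ i"
proof -
  have C: "linear_code n C"
    using LCD by (simp add: hermitian_LCD_def)
  have "finite (UNIV :: 'a set)"
    using card by (simp add: card_ge_0_finite)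
  then have "finite C"
    using finite_carrier_vec C by (metis finite_subset linear_code_iff)
  have "\<exists>a\<in>C. \<forall>x\<in>C. x $ i = herm_inner x a"
  \<comment> \<open>With \<open>S = C\<close> the common kernel is the intersection of
    \<open>C\<close> with its dual, which is zero by the LCD property.\<close>
  proof (rule functional_represented[OF card C \<open>finite C\<close> subset_refl])
    fix x y assume "x \<in> C" "y \<in> C"
    then have "x \<in> carrier_vec n" "y \<in> carrier_vec n"
      using linear_code_carrier[OF C] by auto
    then show "(x + y) $ i = x $ i + y $ i"
      using i by simp
  next
    fix c x assume "x \<in> C"
    then have "x \<in> carrier_vec n"
      using linear_code_carrier[OF C] by auto
    then show "(c \<cdot>\<^sub>v x) $ i = c * x $ i"
      using i by simp
  next
    fix x assume "x \<in> C" "\<forall>y\<in>C. herm_inner x y = 0"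
    then have "x \<in> C \<inter> herm_dual n C"
      using linear_code_carrier[OF C] by (auto simp: herm_dual_def)
    then have "x = 0\<^sub>v n"
      using LCD unfolding hermitian_LCD_def by blast
    then show "x $ i = 0"
      using i by simp
  qed
  with that show thesis by auto
qed

section \<open>Deleting a coordinate\<close>

lemma dim_delete_coord [simp]: "dim_vec (delete_coord i v) = dim_vec v - 1"
  by (simp add: delete_coord_def)

lemma delete_coord_carrier: "v \<in> carrier_vec n \<Longrightarrow> delete_coord i v \<in> carrier_vec (n - 1)"
  by (metis carrier_vecD carrier_vecI dim_delete_coord)

lemma insert_index_less: "j < n - 1 \<Longrightarrow> insert_index i j < n"
  unfolding insert_index_def by presburger

lemma delete_coord_add:
  assumes "u \<in> carrier_vec n" "v \<in> carrier_vec n"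
  shows "delete_coord i (u + v) = delete_coord i u + delete_coord i v"
  using assms by (intro eq_vecI) (auto simp: delete_coord_def insert_index_less)

lemma delete_coord_smult: "delete_coord i (c \<cdot>\<^sub>v v) = c \<cdot>\<^sub>v delete_coord i v"
  by (intro eq_vecI) (auto simp: delete_coord_def insert_index_less)

lemma delete_coord_zero: "delete_coord i (0\<^sub>v n) = 0\<^sub>v (n - 1)"
  by (intro eq_vecI) (auto simp: delete_coord_def insert_index_less)

lemma insert_index_bij:
  assumes "i < n"
  shows "bij_betw (insert_index i) {..<n - 1} ({..<n} - {i})"
proof -
  have "insert_index i ` {..<n - 1} = {..<n} - {i}"
    using assms insert_index_image[of i "n - 1"] by (cases n) (auto simp: atLeast0LessThan)
  then show ?thesis
    by (simp add: bij_betw_def insert_index_inj_on)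
qed

text \<open>Reindexing along \<open>insert_index i\<close> gives the sum over all positions other
  than \<open>i\<close>; the extra summand is the term at \<open>i\<close>.\<close>

lemma herm_inner_delete_coord:
  assumes i: "i < n" and uv: "u \<in> carrier_vec n" "v \<in> carrier_vec n"
  shows "herm_inner u v = herm_inner (delete_coord i u) (delete_coord i v) + u $ i * conj4 (v $ i)"
proof -
  have "herm_inner (delete_coord i u) (delete_coord i v) =
      (\<Sum>j<n - 1. u $ insert_index i j * conj4 (v $ insert_index i j))"
    using uv by (subst herm_inner_sum[OF delete_coord_carrier]) (auto simp: delete_coord_def)
  also have "\<dots> = (\<Sum>j\<in>{..<n} - {i}. u $ j * conj4 (v $ j))"
    by (rule sum.reindex_bij_betw[OF insert_index_bij[OF i]])
  finally show ?thesis
    using i uv by (simp add: herm_inner_sum sum.remove[of "{..<n}" i] add.commute)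
qed

lemma delete_coord_eq_zeroD:
  assumes i: "i < n" and v: "v \<in> carrier_vec n" and del: "delete_coord i v = 0\<^sub>v (n - 1)"
    and j: "j < n" "j \<noteq> i"
  shows "v $ j = 0"
proof -
  have "j \<in> insert_index i ` {..<n - 1}"
    using bij_betw_imp_surj_on[OF insert_index_bij[OF i]] j by simp
  then obtain l where l: "l < n - 1" "insert_index i l = j"
    by auto
  then have "v $ j = delete_coord i v $ l"
    using v by (simp add: delete_coord_def)
  then show ?thesis
    using l del by simp
qed

text \<open>Both weight hypotheses of the theorem are used by contradicting this bound: once for a
  unit vector in the dual, once for a codeword.\<close>

lemma weight_le_1:
  assumes "v \<in> carrier_vec n" "\<And>j. j < n \<Longrightarrow> j \<noteq> i \<Longrightarrow> v $ j = 0"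
  shows "weight v \<le> 1"
proof -
  have "{j. j < dim_vec v \<and> v $ j \<noteq> 0} \<subseteq> {i}"
    using assms by auto
  from card_mono[OF _ this] show ?thesis
    by (simp add: weight_def)
qed

lemma linear_code_delete_coord:
  fixes D :: "'a::field vec set"
  assumes "linear_code n D"
  shows "linear_code (n - 1) (delete_coord i ` D)"
  unfolding linear_code_iff
proof (intro conjI ballI allI)
  note D = assms[unfolded linear_code_iff]
  show "delete_coord i ` D \<subseteq> carrier_vec (n - 1)"
    using D delete_coord_carrier by blast
  show "0\<^sub>v (n - 1) \<in> delete_coord i ` D"
    using D by (metis delete_coord_zero image_eqI)
next
  fix x y assume "x \<in> delete_coord i ` D" "y \<in> delete_coord i ` D"
  then obtain u v where "u \<in> D" "x = delete_coord i u" "v \<in> D" "y = delete_coord i v"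
    by auto
  then show "x + y \<in> delete_coord i ` D"
    using linear_code_carrier[OF assms] linear_code_add[OF assms]
    by (metis delete_coord_add image_eqI)
next
  fix c x assume "x \<in> delete_coord i ` D"
  then show "c \<cdot>\<^sub>v x \<in> delete_coord i ` D"
    using linear_code_smult[OF assms] by (auto simp flip: delete_coord_smult)
qed

lemma linear_code_zero_coord:
  fixes C :: "'a::field vec set"
  assumes C: "linear_code n C" and i: "i < n"
  shows "linear_code n {c \<in> C. c $ i = 0}"
  using assms by (auto simp: linear_code_iff subset_iff)

text \<open>The zero vector always lies in the radical, so only the other inclusion counts, and it
  is pulled back along \<open>delete_coord i\<close>. Taking for \<open>D\<close> either
  \<open>C\<close> or its subcode vanishing at \<open>i\<close> covers puncturing and shortening
  alike.\<close>

lemma delete_coord_LCD_iff: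
  fixes D :: "'a::field vec set"
  assumes D: "linear_code n D"
  shows "hermitian_LCD (n - 1) (delete_coord i ` D) \<longleftrightarrow>
    (\<forall>x\<in>D. (\<forall>y\<in>D. herm_inner (delete_coord i x) (delete_coord i y) = 0) \<longrightarrow>
      delete_coord i x = 0\<^sub>v (n - 1))"
proof -
  have L: "linear_code (n - 1) (delete_coord i ` D)"
    using D by (rule linear_code_delete_coord)
  have "0\<^sub>v (n - 1) \<in> delete_coord i ` D \<inter> herm_dual (n - 1) (delete_coord i ` D)"
    using L linear_code_carrier[OF L] herm_inner_zero_left[of _ "n - 1"]
    unfolding linear_code_iff herm_dual_def by blast
  then have "hermitian_LCD (n - 1) (delete_coord i ` D) \<longleftrightarrow>
      (\<forall>u\<in>delete_coord i ` D. u \<in> herm_dual (n - 1) (delete_coord i ` D) \<longrightarrow> u = 0\<^sub>v (n - 1))"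
    unfolding hermitian_LCD_def using L by blast
  also have "\<dots> \<longleftrightarrow> (\<forall>x\<in>D. (\<forall>y\<in>D. herm_inner (delete_coord i x) (delete_coord i y) = 0) \<longrightarrow>
      delete_coord i x = 0\<^sub>v (n - 1))"
    using delete_coord_carrier[OF linear_code_carrier[OF D]] by (simp add: herm_dual_def)
  finally show ?thesis .
qed

section \<open>Comparing the two radicals\<close>

theorem theorem4p2:
  fixes C :: "'a::field vec set" and n k d d' :: nat
  assumes "CARD('a) = 4"
    and "nkd_code n k d C"
    and "hermitian_LCD n C"
    and "is_min_weight n (herm_dual n C) d'"
    and "d \<ge> 2"
    and "d' \<ge> 2"
  shows "\<forall>i<n. hermitian_LCD (n - 1) (punctured i C) \<noteq> hermitian_LCD (n - 1) (shortened i C)"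
proof (intro allI impI)
  fix i assume i: "i < n"
  note card = assms(1)
  have C: "linear_code n C"
    using assms(3) by (simp add: hermitian_LCD_def)
  note carr = linear_code_carrier[OF C] and add = linear_code_add[OF C]
    and smult = linear_code_smult[OF C]
  obtain a where a: "a \<in> C" and rep: "\<And>x. x \<in> C \<Longrightarrow> herm_inner x a = x $ i"
    using LCD_coordinate_represented[OF card assms(3) i] by metis
  have rep': "herm_inner a x = conj4 (x $ i)" if "x \<in> C" for x
    using herm_inner_commute[OF card carr[OF that] carr[OF a]] rep[OF that] by simp
  have LCD: "x = 0\<^sub>v n" if "x \<in> C" "\<And>y. y \<in> C \<Longrightarrow> herm_inner x y = 0" for x
  proof -
    have "x \<in> C \<inter> herm_dual n C"
      using that carr by (auto simp: herm_dual_def)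
    then show ?thesis
      using assms(3) unfolding hermitian_LCD_def by blast
  qed
  \<comment> \<open>Otherwise all codewords vanish at \<open>i\<close>, and the unit vector at
    \<open>i\<close> is a dual word of weight one.\<close>
  have "a \<noteq> 0\<^sub>v n"
  proof
    assume "a = 0\<^sub>v n"
    then have "x $ i = 0" if "x \<in> C" for x
      using rep[OF that] by (simp add: herm_inner_sum[where n = n])
    then have "herm_inner (unit_vec n i) x = 0" if "x \<in> C" for x
      using that i carr[OF that] by (simp add: herm_inner_def)
    then have "unit_vec n i \<in> herm_dual n C"
      by (simp add: herm_dual_def)
    moreover have "unit_vec n i \<noteq> (0\<^sub>v n :: 'a vec)"
      using i by (metis index_unit_vec(1) index_zero_vec(1) zero_neq_one)
    ultimately have "d' \<le> weight (unit_vec n i :: 'a vec)"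
      using assms(4) unfolding is_min_weight_def by blast
    moreover have "weight (unit_vec n i :: 'a vec) \<le> 1"
      using i by (intro weight_le_1[of _ n i]) auto
    ultimately show False
      using assms(6) by simp
  qed
  \<comment> \<open>Otherwise \<open>a\<close> is a nonzero codeword supported at \<open>i\<close>
    alone.\<close>
  have del: "delete_coord i a \<noteq> 0\<^sub>v (n - 1)"
  proof
    assume "delete_coord i a = 0\<^sub>v (n - 1)"
    then have "weight a \<le> 1"
      using carr[OF a] by (intro weight_le_1[of _ n i] delete_coord_eq_zeroD[OF i])
    moreover have "d \<le> weight a"
      using assms(2) a \<open>a \<noteq> 0\<^sub>v n\<close> unfolding nkd_code_def is_min_weight_def by blast
    ultimately show False
      using assms(5) by simp
  qed
  have "conj4 (a $ i) = a $ i"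
    using rep[OF a] rep'[OF a] by simp
  then have cases: "a $ i = 0 \<or> a $ i = 1"
    by (simp add: conj4_def power2_eq_square)
  have inner: "herm_inner (delete_coord i x) (delete_coord i y) =
      herm_inner x y - x $ i * conj4 (y $ i)" if "x \<in> C" "y \<in> C" for x y
    using herm_inner_delete_coord[OF i carr carr] that by simp
  \<comment> \<open>By \<open>rep'\<close>, the vectors \<open>x\<close> and \<open>t\<close> times
    \<open>a\<close> have the same inner product with every codeword, so their difference is zero by
    \<open>LCD\<close>. This identifies the candidates for radical vectors in both cases
    below.\<close>
  have multiple: "x = t \<cdot>\<^sub>v a"
    if x: "x \<in> C" and orth: "\<And>y. y \<in> C \<Longrightarrow> herm_inner x y = t * conj4 (y $ i)" for x t
  proof -
    have "herm_inner (x + (- t) \<cdot>\<^sub>v a) y = 0" if "y \<in> C" for y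
      using that x a orth rep' carr smult
      by (simp add: herm_inner_add_left[where n = n] herm_inner_smult_left[where n = n])
    then have zero: "x + (- t) \<cdot>\<^sub>v a = 0\<^sub>v n"
      by (intro LCD add smult x a)
    have "x $ j = (t \<cdot>\<^sub>v a) $ j" if "j < n" for j
      using arg_cong[OF zero, of "\<lambda>v. v $ j"] that carr[OF x] carr[OF a] by simp
    then show ?thesis
      using carr[OF x] carr[OF a] by (intro eq_vecI) auto
  qed
  let ?D = "{c \<in> C. c $ i = 0}"
  have punc: "hermitian_LCD (n - 1) (punctured i C) \<longleftrightarrow>
      (\<forall>x\<in>C. (\<forall>y\<in>C. herm_inner x y = x $ i * conj4 (y $ i)) \<longrightarrow> delete_coord i x = 0\<^sub>v (n - 1))"
    unfolding punctured_def delete_coord_LCD_iff[OF C] by (simp add: inner)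
  \<comment> \<open>On \<open>?D\<close> the correction term in \<open>inner\<close> vanishes, so
    deletion preserves the form there.\<close>
  have short: "hermitian_LCD (n - 1) (shortened i C) \<longleftrightarrow>
      (\<forall>x\<in>?D. (\<forall>y\<in>?D. herm_inner x y = 0) \<longrightarrow> delete_coord i x = 0\<^sub>v (n - 1))"
    unfolding shortened_def delete_coord_LCD_iff[OF linear_code_zero_coord[OF C i]]
    by (simp add: inner)
  have "0 \<cdot>\<^sub>v a = 0\<^sub>v n"
    using carr[OF a] by (intro eq_vecI) auto
  then have zero: "delete_coord i (0 \<cdot>\<^sub>v a) = 0\<^sub>v (n - 1)"
    by (simp add: delete_coord_zero)
  from cases show "hermitian_LCD (n - 1) (punctured i C) \<noteq> hermitian_LCD (n - 1) (shortened i C)"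
  proof
    assume ai: "a $ i = 0"
    have "hermitian_LCD (n - 1) (punctured i C)"
      unfolding punc
    proof (intro ballI impI)
      fix x assume x: "x \<in> C" "\<forall>y\<in>C. herm_inner x y = x $ i * conj4 (y $ i)"
      then have eq: "x = x $ i \<cdot>\<^sub>v a"
        by (intro multiple) auto
      \<comment> \<open>Reading the equation at coordinate \<open>i\<close> forces the scalar, and
        hence \<open>x\<close>, to be zero.\<close>
      have "x $ i = x $ i * a $ i"
        using arg_cong[OF eq, of "\<lambda>v. v $ i"] carr[OF a] i by simp
      with ai have "x $ i = 0" by simp
      with eq zero show "delete_coord i x = 0\<^sub>v (n - 1)" by simp
    qed
    \<comment> \<open>Now \<open>a\<close> itself lies in \<open>?D\<close> and, by
      \<open>rep'\<close>, is orthogonal to all of \<open>?D\<close>.\<close>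
    moreover have "\<not> hermitian_LCD (n - 1) (shortened i C)"
      unfolding short using a ai del rep' by auto
    ultimately show ?thesis by simp
  next
    assume ai: "a $ i = 1"
    have "hermitian_LCD (n - 1) (shortened i C)"
      unfolding short
    proof (intro ballI impI)
      fix x assume x: "x \<in> ?D" "\<forall>y\<in>?D. herm_inner x y = 0"
      \<comment> \<open>Orthogonality to \<open>?D\<close> extends to all of \<open>C\<close>; the
        factor 0 matches \<open>multiple\<close> with \<open>t = 0\<close>.\<close>
      have "herm_inner x y = 0 * conj4 (y $ i)" if y: "y \<in> C" for y
      proof -
        \<comment> \<open>As \<open>a $ i = 1\<close>, this correction moves \<open>y\<close> into
          \<open>?D\<close>. It leaves the inner product with \<open>x\<close> unchanged, because
          \<open>herm_inner x a = x $ i = 0\<close>.\<close>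
        let ?z = "y + (- (y $ i)) \<cdot>\<^sub>v a"
        have "?z \<in> ?D"
          using y a ai i carr[OF y] carr[OF a] by (simp add: add smult)
        then have "herm_inner x ?z = 0"
          using x by blast
        moreover have "herm_inner x ?z = herm_inner x y"
          using x y a carr smult rep
          by (simp add: herm_inner_add_right[OF card, where n = n]
              herm_inner_smult_right[OF card, where n = n])
        ultimately show ?thesis by simp
      qed
      then have "x = 0 \<cdot>\<^sub>v a"
        using x by (intro multiple) auto
      with zero show "delete_coord i x = 0\<^sub>v (n - 1)" by simp
    qed
    moreover have "\<not> hermitian_LCD (n - 1) (punctured i C)"
    proof -
      \<comment> \<open>With \<open>a $ i = 1\<close>, \<open>rep'\<close> is exactly the condition
        in \<open>punc\<close> for the image of \<open>a\<close> to lie in the radical.\<close>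
      have "\<forall>y\<in>C. herm_inner a y = a $ i * conj4 (y $ i)"
        using ai rep' by simp
      with a del show ?thesis
        unfolding punc by blast
    qed
    ultimately show ?thesis by simp
  qed
qed

end
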